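(* Let $n\ge 2$ and let $f:\mathbb{R}^{n\times n}\to\mathbb{R}$ be continuous and quasi-convex, and integer valued on $\mathrm{vert}(P)$, where $P$ is the Birkhoff polytope. Let $\delta\in(0,1)$ be such that $|f(x)-f(y)|<\tfrac12$ whenever $x$ is a vertex of $P$ and $\|x-y\|<\delta$. Let $t\in\left(0,\frac{\delta}{n(2n-1)}\right)$ and let $P'=P'_t$ be the perturbed polytope. Let $\mathcal{B}^*$ be a basis of the constraint matrix $A$ such that the basic solution $x^*$ of $\mathcal{B}^*$ with respect to the right-hand side $b'$ is feasible (i.e. $x^*\in P'$) and $f(x^* )=\max_{x\in P'} f(x)$. Let $\hat{x}$ be the basic solution of $\mathcal{B}^*$ with respect to the right-hand side $b$. Then $\hat{x}\in P$ (i.e. $\mathcal{B}^*$ is a feasible basis for $P$) and $f(\hat{x})=\max_{x\in P} f(x)$, i.e. $\mathcal{B}^*$ is also an optimal basis for $P$.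
   Context: Variables are $x=(x_{ij})\in\mathbb{R}^{n\times n}$, and $\|x\|=(\sum_{i,j}x_{ij}^2)^{1/2}$. Let $A$ be the $(2n-1)\times n^2$ matrix of the linear system consisting of the $n$ row-sum equations $\sum_{j=1}^n x_{ij}$ ($i=1,\dots,n$) and the $n-1$ column-sum equations $\sum_{i=1}^n x_{ij}$ ($j=1,\dots,n-1$); $A$ has full row rank. The Birkhoff polytope is $P=\{x: \sum_{j}x_{ij}=1\ (i=1,\dots,n),\ \sum_i x_{ij}=1\ (j=1,\dots,n-1),\ x\ge 0\}$, i.e. $\{x: Ax=b,\ x\ge 0\}$ with $b$ the all-ones vector (equivalently, the set of $n\times n$ doubly stochastic matrices; its vertices are the permutation matrices). For a parameter $t$, the perturbed polytope is $P'_t=\{x:\sum_j x_{ij}=1-t\ (i=1,\dots,n),\ \sum_i x_{ij}=1\ (j=1,\dots,n-1),\ x\ge0\}=\{x: Ax=b',x\ge0\}$, where $b'$ has entries $1-t$ in the $n$ row-sum positions and $1$ in the $n-1$ column-sum positions. A basis is a set of $2n-1$ linearly independent columns $A_{\pi(1)},\dots,A_{\pi(2n-1)}$ of $A$, forming the invertible matrix $B$; its basic solution with respect to a right-hand side $c$ is the $x$ with $x_{\pi(i)}=(B^{-1}c)_i$ and all other coordinates $0$. *)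

theory Defs
  imports "HOL-Analysis.Analysis"
begin

text \<open>
  The dimension is \<open>n = CARD('m option)\<close>, so \<open>n = CARD('m) + 1\<close> with \<open>'m\<close> an arbitrary
  nonempty finite type: \<open>Some j\<close> ranges over the column indices \<open>1, \<dots>, n - 1\<close> and \<open>None\<close>
  is the last index \<open>n\<close>, whose column-sum equation is omitted.  Every \<open>n \<ge> 2\<close> arises in this
  way.  A point \<open>x\<close> of \<open>n \<times> n\<close> real space is a vector indexed by pairs, with entry
  \<open>x $ (i, j)\<close>, so that \<open>norm x\<close> is the root of the sum of the squared entries.  The
  \<open>2 * n - 1\<close> equations are indexed by \<open>'m option + 'm\<close>: \<open>Inl i\<close> is the \<open>i\<close>-th row sum
  and \<open>Inr j\<close> the column sum of the column \<open>Some j\<close>.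
\<close>

type_synonym 'm point = "real ^ ('m option \<times> 'm option)"
type_synonym 'm rhs = "real ^ ('m option + 'm)"

lemma card_option_ge_2: "2 \<le> CARD('m::finite option)"
  using zero_less_card_finite[where 'a = 'm] by (simp add: card_UNIV_option del: zero_less_card_finite)

definition constraint_matrix ::
  "real ^ ('m::finite option \<times> 'm option) ^ ('m option + 'm)" where
  "constraint_matrix = (\<chi> r k. case r of
      Inl i \<Rightarrow> (if fst k = i then 1 else 0)
    | Inr j \<Rightarrow> (if snd k = Some j then 1 else 0))"

definition birkhoff_polytope :: "'m::finite point set" where
  "birkhoff_polytope = {x.
     (\<forall>i. (\<Sum>j\<in>UNIV. x $ (i, j)) = 1) \<and>
     (\<forall>j. (\<Sum>i\<in>UNIV. x $ (i, Some j)) = 1) \<and>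
     (\<forall>k. 0 \<le> x $ k)}"

definition perturbed_polytope :: "real \<Rightarrow> 'm::finite point set" where
  "perturbed_polytope t = {x.
     (\<forall>i. (\<Sum>j\<in>UNIV. x $ (i, j)) = 1 - t) \<and>
     (\<forall>j. (\<Sum>i\<in>UNIV. x $ (i, Some j)) = 1) \<and>
     (\<forall>k. 0 \<le> x $ k)}"

definition birkhoff_rhs :: "'m::finite rhs" where
  "birkhoff_rhs = (\<chi> r. 1)"

definition perturbed_rhs :: "real \<Rightarrow> 'm::finite rhs" where
  "perturbed_rhs t = (\<chi> r. case r of Inl i \<Rightarrow> 1 - t | Inr j \<Rightarrow> 1)"

lemma constraint_matrix_Inl:
  "(constraint_matrix *v x) $ Inl i = (\<Sum>j\<in>UNIV. x $ (i, j))"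
proof -
  have "(constraint_matrix *v x) $ Inl i
      = (\<Sum>k\<in>UNIV \<times> UNIV. (if fst k = i then 1 else 0) * x $ k)"
    by (simp add: constraint_matrix_def matrix_vector_mult_def)
  also have "\<dots> = (\<Sum>a\<in>UNIV. \<Sum>j\<in>UNIV. (if a = i then 1 else 0) * x $ (a, j))"
    by (simp only: sum.cartesian_product) (simp add: case_prod_unfold)
  also have "\<dots> = (\<Sum>a\<in>UNIV. if a = i then \<Sum>j\<in>UNIV. x $ (a, j) else 0)"
    by (intro sum.cong) auto
  finally show ?thesis by simp
qed

lemma constraint_matrix_Inr:
  "(constraint_matrix *v x) $ Inr j = (\<Sum>i\<in>UNIV. x $ (i, Some j))"
proof -
  have "(constraint_matrix *v x) $ Inr j
      = (\<Sum>k\<in>UNIV \<times> UNIV. (if snd k = Some j then 1 else 0) * x $ k)"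
    by (simp add: constraint_matrix_def matrix_vector_mult_def)
  also have "\<dots> = (\<Sum>a\<in>UNIV. \<Sum>c\<in>UNIV. (if c = Some j then 1 else 0) * x $ (a, c))"
    by (simp only: sum.cartesian_product) (simp add: case_prod_unfold)
  also have "\<dots> = (\<Sum>a\<in>UNIV. \<Sum>c\<in>UNIV. if c = Some j then x $ (a, c) else 0)"
    by (intro sum.cong) auto
  finally show ?thesis by simp
qed

lemma birkhoff_polytope_eq:
  "birkhoff_polytope = {x. constraint_matrix *v x = birkhoff_rhs \<and> (\<forall>k. 0 \<le> x $ k)}"
proof -
  have "constraint_matrix *v x = birkhoff_rhs \<longleftrightarrow>
      (\<forall>i. (\<Sum>j\<in>UNIV. x $ (i, j)) = 1) \<and> (\<forall>j. (\<Sum>i\<in>UNIV. x $ (i, Some j)) = 1)"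
    for x :: "'a point"
    unfolding vec_eq_iff split_sum_all constraint_matrix_Inl constraint_matrix_Inr
    by (simp add: birkhoff_rhs_def)
  then show ?thesis by (auto simp: birkhoff_polytope_def)
qed

lemma perturbed_polytope_eq:
  "perturbed_polytope t =
     {x. constraint_matrix *v x = perturbed_rhs t \<and> (\<forall>k. 0 \<le> x $ k)}"
proof -
  have "constraint_matrix *v x = perturbed_rhs t \<longleftrightarrow>
      (\<forall>i. (\<Sum>j\<in>UNIV. x $ (i, j)) = 1 - t) \<and> (\<forall>j. (\<Sum>i\<in>UNIV. x $ (i, Some j)) = 1)"
    for x :: "'a point"
    unfolding vec_eq_iff split_sum_all constraint_matrix_Inl constraint_matrix_Inr
    by (simp add: perturbed_rhs_def)
  then show ?thesis by (auto simp: perturbed_polytope_def)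
qed

text \<open>
  A basis is given by an enumeration \<open>\<pi>\<close> of its columns by the row index type \<open>'r\<close>; it therefore
  consists of \<open>CARD('r)\<close> columns, and the matrix of these columns is square.
\<close>

definition is_basis :: "real ^ 'c::finite ^ 'r::finite \<Rightarrow> ('r \<Rightarrow> 'c) \<Rightarrow> bool" where
  "is_basis A \<pi> \<longleftrightarrow>
     inj (\<lambda>r. column (\<pi> r) A) \<and> independent (range (\<lambda>r. column (\<pi> r) A))"

definition basis_matrix :: "real ^ 'c::finite ^ 'r::finite \<Rightarrow> ('r \<Rightarrow> 'c) \<Rightarrow> real ^ 'r ^ 'r" where
  "basis_matrix A \<pi> = (\<chi> i r. A $ i $ \<pi> r)"

definition basic_solution ::
  "real ^ 'c::finite ^ 'r::finite \<Rightarrow> ('r \<Rightarrow> 'c) \<Rightarrow> real ^ 'r \<Rightarrow> real ^ 'c" where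
  "basic_solution A \<pi> c = (\<chi> k.
     if k \<in> range \<pi> then (matrix_inv (basis_matrix A \<pi>) *v c) $ inv \<pi> k else 0)"

definition quasi_convex :: "('a::real_vector \<Rightarrow> real) \<Rightarrow> bool" where
  "quasi_convex f \<longleftrightarrow>
     (\<forall>x y u. 0 \<le> u \<and> u \<le> 1 \<longrightarrow> f (u *\<^sub>R x + (1 - u) *\<^sub>R y) \<le> max (f x) (f y))"

end

theory Submission
  imports Defs
begin

text \<open>
  The inverse of every basis matrix has entries in \<open>{-1, 0, 1}\<close>.  Hence \<open>xhat\<close> is integral and
  differs from \<open>xstar\<close> by at most \<open>n * t < 1\<close> in each of its at most \<open>2 * n - 1\<close> nonzero
  entries; so it is nonnegative, a vertex of \<open>P\<close>, and \<open>\<delta>\<close>-close to \<open>xstar\<close>.  Conversely every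
  vertex \<open>v\<close> of \<open>P\<close> is \<open>\<delta>\<close>-close to some point of \<open>P'\<close>.  Together this gives
  \<open>f v < f xhat + 1\<close>, and integrality of both values gives \<open>f v \<le> f xhat\<close>.  A quasi-convex function
  bounded on the vertices is bounded by the same constant on their convex hull \<open>P\<close>.
\<close>

section \<open>Bases and their basic solutions\<close>

lemma matrix_vector_mult_supported:
  fixes A :: "real ^ 'c::finite ^ 'r::finite"
  assumes "inj \<pi>" and supp: "\<And>k. k \<notin> range \<pi> \<Longrightarrow> x $ k = 0"
  shows "A *v x = basis_matrix A \<pi> *v (\<chi> r. x $ \<pi> r)"
proof -
  have "(\<Sum>k\<in>UNIV. A $ i $ k * x $ k) = (\<Sum>r\<in>UNIV. A $ i $ \<pi> r * x $ \<pi> r)" for i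
  proof -
    have "(\<Sum>k\<in>UNIV. A $ i $ k * x $ k) = (\<Sum>k\<in>range \<pi>. A $ i $ k * x $ k)"
      by (intro sum.mono_neutral_right) (auto simp: supp)
    also have "\<dots> = (\<Sum>r\<in>UNIV. A $ i $ \<pi> r * x $ \<pi> r)"
      using \<open>inj \<pi>\<close> by (simp add: sum.reindex)
    finally show ?thesis .
  qed
  then show ?thesis
    by (simp add: vec_eq_iff matrix_vector_mult_def basis_matrix_def)
qed

lemma is_basis_inj: "is_basis A \<pi> \<Longrightarrow> inj \<pi>"
  unfolding is_basis_def inj_def by metis

lemma is_basis_invertible:
  fixes A :: "real ^ 'c::finite ^ 'r::finite"
  assumes "is_basis A \<pi>"
  shows "invertible (basis_matrix A \<pi>)"
proof -
  let ?a = "\<lambda>r. column (\<pi> r) A"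
  have inj: "inj ?a" and ind: "independent (range ?a)"
    using assms by (auto simp: is_basis_def)
  have "c r = 0" if c: "(\<Sum>r\<in>UNIV. c r *s column r (basis_matrix A \<pi>)) = 0" for c r
  proof -
    \<comment> \<open>Independence concerns the set of columns; injectivity lets
      \<open>inv ?a\<close> turn coefficients indexed by \<open>r\<close> into coefficients on that
      set.\<close>
    have "(\<Sum>v\<in>range ?a. c (inv ?a v) *\<^sub>R v) = (\<Sum>r\<in>UNIV. c r *\<^sub>R ?a r)"
      by (simp add: sum.reindex[OF inj] inv_f_f[OF inj])
    also have "\<dots> = 0"
      using c by (simp add: column_def basis_matrix_def scalar_mult_eq_scaleR)
    finally have "c (inv ?a (?a r)) = 0"
      by (intro independentD[OF ind, where t = "range ?a" and u = "\<lambda>v. c (inv ?a v)"]) auto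
    then show ?thesis
      by (simp add: inv_f_f[OF inj])
  qed
  then show ?thesis
    unfolding invertible_left_inverse matrix_left_invertible_independent_columns by blast
qed

lemma basic_solution_notin_range: "k \<notin> range \<pi> \<Longrightarrow> basic_solution A \<pi> c $ k = 0"
  by (simp add: basic_solution_def)

lemma basic_solution_nth:
  "inj \<pi> \<Longrightarrow> basic_solution A \<pi> c $ \<pi> r = (matrix_inv (basis_matrix A \<pi>) *v c) $ r"
  by (simp add: basic_solution_def)

lemma basis_matrix_inv:
  assumes "is_basis A \<pi>"
  shows "basis_matrix A \<pi> ** matrix_inv (basis_matrix A \<pi>) = mat 1"
    and "matrix_inv (basis_matrix A \<pi>) ** basis_matrix A \<pi> = mat 1"
  using someI_ex[OF is_basis_invertible[OF assms, unfolded invertible_def]]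
  by (simp_all add: matrix_inv_def)

lemma constraint_basic_solution:
  assumes "is_basis A \<pi>"
  shows "A *v basic_solution A \<pi> c = c"
proof -
  have inj: "inj \<pi>"
    using assms by (rule is_basis_inj)
  have "A *v basic_solution A \<pi> c
      = basis_matrix A \<pi> *v (\<chi> r. basic_solution A \<pi> c $ \<pi> r)"
    by (rule matrix_vector_mult_supported[OF inj basic_solution_notin_range])
  also have "(\<chi> r. basic_solution A \<pi> c $ \<pi> r) = matrix_inv (basis_matrix A \<pi>) *v c"
    by (simp add: vec_eq_iff basic_solution_nth[OF inj])
  finally show ?thesis
    by (simp add: matrix_vector_mul_assoc basis_matrix_inv[OF assms])
qed

lemma basic_solution_unique:
  assumes "is_basis A \<pi>" and supp: "\<And>k. k \<notin> range \<pi> \<Longrightarrow> x $ k = 0"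
  shows "x = basic_solution A \<pi> (A *v x)"
proof -
  have inj: "inj \<pi>"
    using assms(1) by (rule is_basis_inj)
  have "matrix_inv (basis_matrix A \<pi>) *v (A *v x) = (\<chi> r. x $ \<pi> r)"
    by (simp add: matrix_vector_mult_supported[OF inj supp] matrix_vector_mul_assoc
        basis_matrix_inv[OF assms(1)])
  then have "x $ \<pi> r = basic_solution A \<pi> (A *v x) $ \<pi> r" for r
    by (simp add: basic_solution_nth[OF inj])
  then have "x $ k = basic_solution A \<pi> (A *v x) $ k" for k
    by (cases "k \<in> range \<pi>") (auto simp: supp basic_solution_notin_range)
  then show ?thesis
    by (simp add: vec_eq_iff)
qed

text \<open>Coordinates off the basis vanish at the basic solution, so nonnegativity makes them
  vanish at both ends of any open segment through it. The basis equations then determine both ends,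
  which must coincide.\<close>

lemma basic_solution_extreme_point:
  assumes "is_basis A \<pi>"
    and nonneg: "\<And>k. 0 \<le> basic_solution A \<pi> c $ k"
  shows "basic_solution A \<pi> c extreme_point_of {x. A *v x = c \<and> (\<forall>k. 0 \<le> x $ k)}"
  unfolding extreme_point_of_def
proof (intro conjI ballI notI)
  let ?x = "basic_solution A \<pi> c"
  show "?x \<in> {x. A *v x = c \<and> (\<forall>k. 0 \<le> x $ k)}"
    by (simp add: nonneg constraint_basic_solution[OF assms(1)])
  fix a b
  assume a: "a \<in> {x. A *v x = c \<and> (\<forall>k. 0 \<le> x $ k)}"
    and b: "b \<in> {x. A *v x = c \<and> (\<forall>k. 0 \<le> x $ k)}"
    and "?x \<in> open_segment a b"
  then obtain u where "a \<noteq> b" and u: "0 < u" "u < 1"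
    and eq: "?x = (1 - u) *\<^sub>R a + u *\<^sub>R b"
    by (auto simp: in_segment)
  have zero: "a $ k = 0 \<and> b $ k = 0" if "k \<notin> range \<pi>" for k
  proof -
    have "(1 - u) * a $ k + u * b $ k = 0"
      using basic_solution_notin_range[OF that, of A c] eq by simp
    moreover have "0 \<le> (1 - u) * a $ k" "0 \<le> u * b $ k"
      using a b u by auto
    ultimately have "(1 - u) * a $ k = 0" "u * b $ k = 0"
      by linarith+
    then show ?thesis
      using u by auto
  qed
  have "a = basic_solution A \<pi> (A *v a)"
    by (rule basic_solution_unique[OF assms(1)]) (simp add: zero)
  moreover have "b = basic_solution A \<pi> (A *v b)"
    by (rule basic_solution_unique[OF assms(1)]) (simp add: zero)
  ultimately show False
    using a b \<open>a \<noteq> b\<close> by simp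
qed

section \<open>Entries of inverse basis matrices\<close>

lemma sum_UNIV_sum:
  fixes g :: "'a::finite + 'b::finite \<Rightarrow> 'c::comm_monoid_add"
  shows "(\<Sum>q\<in>UNIV. g q) = (\<Sum>i\<in>UNIV. g (Inl i)) + (\<Sum>j\<in>UNIV. g (Inr j))"
  unfolding UNIV_Plus_UNIV[symmetric] by (subst sum.Plus) auto

text \<open>A column of the matrix is the incidence vector of an edge of the complete bipartite
  graph; omitting one equation amounts to the value 0 at the column vertex
  \<open>None\<close>.\<close>

lemma sum_constraint_matrix_column:
  fixes u :: "'m::finite option + 'm \<Rightarrow> real"
  shows "(\<Sum>q\<in>UNIV. u q * constraint_matrix $ q $ (i, j))
       = u (Inl i) + (case j of None \<Rightarrow> 0 | Some j' \<Rightarrow> u (Inr j'))"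
proof -
  have "(\<Sum>q\<in>UNIV. u q * constraint_matrix $ q $ (i, j))
      = (\<Sum>a\<in>UNIV. if a = i then u (Inl a) else 0)
        + (\<Sum>b\<in>UNIV. if j = Some b then u (Inr b) else 0)"
    unfolding sum_UNIV_sum constraint_matrix_def
    by (intro arg_cong2[where f = "(+)"] sum.cong) auto
  then show ?thesis
    by (cases j) auto
qed

text \<open>
  A row \<open>w\<close> of the inverse, with column entries negated, is a potential on the vertices of the
  bipartite graph that vanishes at the column \<open>None\<close> and is constant along all basis edges but one.
  The indicator \<open>u\<close> of its support, with the same signs, has these properties as well, so
  \<open>u\<close> is a multiple \<open>c * w\<close>, where \<open>c\<close> is the jump of \<open>u\<close> along the
  exceptional edge.
\<close>

lemma constraint_basis_inverse_entry:
  fixes \<pi> :: "'m::finite option + 'm \<Rightarrow> 'm option \<times> 'm option"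
  assumes "is_basis constraint_matrix \<pi>"
  shows "matrix_inv (basis_matrix constraint_matrix \<pi>) $ r\<^sub>0 $ q \<in> {-1, 0, 1}"
proof -
  define B where "B = basis_matrix constraint_matrix \<pi>"
  define W where "W = matrix_inv B"
  define w where "w = (\<lambda>q. W $ r\<^sub>0 $ q)"
  define u :: "'m option + 'm \<Rightarrow> real" where
    "u = (\<lambda>q. if w q = 0 then 0 else case q of Inl i \<Rightarrow> 1 | Inr j \<Rightarrow> -1)"
  have BW: "(\<Sum>r\<in>UNIV. B $ p $ r * W $ r $ q) = (if p = q then 1 else 0)" for p q
    using arg_cong[OF basis_matrix_inv(1)[OF assms], of "\<lambda>M. M $ p $ q"]
    by (simp add: B_def W_def matrix_matrix_mult_def mat_def)
  have wB: "(\<Sum>q\<in>UNIV. w q * B $ q $ r) = (if r = r\<^sub>0 then 1 else 0)" for r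
    using arg_cong[OF basis_matrix_inv(2)[OF assms], of "\<lambda>M. M $ r\<^sub>0 $ r"]
    by (auto simp: B_def W_def w_def matrix_matrix_mult_def mat_def)
  have col: "(\<Sum>q\<in>UNIV. v q * B $ q $ r)
      = v (Inl (fst (\<pi> r))) + (case snd (\<pi> r) of None \<Rightarrow> 0 | Some j \<Rightarrow> v (Inr j))" for v r
    using sum_constraint_matrix_column[of v "fst (\<pi> r)" "snd (\<pi> r)"]
    by (simp add: B_def basis_matrix_def)
  define c where "c = (\<Sum>q\<in>UNIV. u q * B $ q $ r\<^sub>0)"
  have c: "c \<in> {-1, 0, 1}"
    unfolding c_def col by (auto simp: u_def split: option.splits)
  \<comment> \<open>For \<open>r \<noteq> r\<^sub>0\<close> the two endpoint values of
    \<open>w\<close> cancel, so they vanish together or not at all, and the opposite signs in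
    \<open>u\<close> cancel too. An edge at \<open>None\<close> forces \<open>w\<close>, hence
    \<open>u\<close>, to be 0 at its row end.\<close>
  have uB: "(\<Sum>q\<in>UNIV. u q * B $ q $ r) = (if r = r\<^sub>0 then c else 0)" for r
  proof (cases "r = r\<^sub>0")
    case False
    with wB[of r] show ?thesis
      unfolding col by (auto simp: u_def split: option.splits)
  qed (simp add: c_def)
  \<comment> \<open>Writing the identity as \<open>B ** W\<close> recovers \<open>u\<close> from its
    edge sums, of which only the one at \<open>r\<^sub>0\<close> can be nonzero.\<close>
  have "u q = (\<Sum>p\<in>UNIV. u p * (if p = q then 1 else 0))"
    by (simp add: if_distrib cong: if_cong)
  also have "\<dots> = (\<Sum>p\<in>UNIV. \<Sum>r\<in>UNIV. u p * B $ p $ r * W $ r $ q)"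
    by (simp only: BW[symmetric] sum_distrib_left mult.assoc)
  also have "\<dots> = (\<Sum>r\<in>UNIV. (\<Sum>p\<in>UNIV. u p * B $ p $ r) * W $ r $ q)"
    by (subst sum.swap) (simp add: sum_distrib_right)
  also have "\<dots> = (\<Sum>r\<in>UNIV. if r = r\<^sub>0 then c * W $ r $ q else 0)"
    by (intro sum.cong) (auto simp: uB)
  also have "\<dots> = c * w q"
    by (simp add: w_def)
  finally have "u q = c * w q" .
  moreover have "w q \<noteq> 0 \<Longrightarrow> u q \<in> {-1, 1}"
    by (auto simp: u_def split: sum.splits)
  \<comment> \<open>Where \<open>w q\<close> is nonzero, \<open>c * w q\<close> is 1 or -1; hence so
    is \<open>c\<close>, and then \<open>w q\<close>.\<close>
  ultimately have "w q \<in> {-1, 0, 1}"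
    using c by (cases "w q = 0") auto
  then show ?thesis
    by (simp add: w_def W_def B_def)
qed

section \<open>Quasi-convex functions on the Birkhoff polytope\<close>

lemma quasi_convex_sublevel_convex:
  assumes "quasi_convex f"
  shows "convex {x. f x \<le> M}"
proof (rule convexI)
  fix x y and u v :: real
  assume *: "x \<in> {x. f x \<le> M}" "y \<in> {x. f x \<le> M}" "0 \<le> u" "0 \<le> v" "u + v = 1"
  then have "f (u *\<^sub>R x + (1 - u) *\<^sub>R y) \<le> max (f x) (f y)"
    using assms by (simp add: quasi_convex_def)
  moreover have "v = 1 - u"
    using * by simp
  ultimately show "u *\<^sub>R x + v *\<^sub>R y \<in> {x. f x \<le> M}"
    using * by force
qed

lemma birkhoff_entry_le_1:
  assumes "x \<in> birkhoff_polytope"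
  shows "x $ k \<le> 1"
proof -
  obtain i j where k: "k = (i, j)"
    by fastforce
  have "x $ (i, j) \<le> (\<Sum>j\<in>UNIV. x $ (i, j))"
    using assms by (intro member_le_sum) (auto simp: birkhoff_polytope_def)
  then show ?thesis
    using assms by (simp add: k birkhoff_polytope_def)
qed

lemma compact_birkhoff_polytope: "compact (birkhoff_polytope :: 'm::finite point set)"
proof -
  have "birkhoff_polytope \<subseteq> cbox (0 :: 'm point) 1"
    by (auto simp: mem_box_cart birkhoff_entry_le_1) (simp add: birkhoff_polytope_def)
  then have "bounded (birkhoff_polytope :: 'm point set)"
    using bounded_cbox bounded_subset by blast
  moreover have "closed (birkhoff_polytope :: 'm point set)"
    unfolding birkhoff_polytope_def
    by (intro closed_Collect_conj closed_Collect_all closed_Collect_eq closed_Collect_le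
        continuous_intros)
  ultimately show ?thesis
    by (simp add: compact_eq_bounded_closed)
qed

lemma convex_birkhoff_polytope: "convex (birkhoff_polytope :: 'm::finite point set)"
  by (rule convexI)
     (simp add: birkhoff_polytope_def sum.distrib flip: sum_distrib_left)

text \<open>By Krein-Milman the polytope is the convex hull of its extreme points, and the sublevel
  set of \<open>f\<close> at \<open>M\<close> is a convex set containing them.\<close>

lemma quasi_convex_le_on_birkhoff:
  fixes f :: "'m::finite point \<Rightarrow> real"
  assumes "quasi_convex f"
    and "\<And>v. v extreme_point_of birkhoff_polytope \<Longrightarrow> f v \<le> M"
    and "x \<in> birkhoff_polytope"
  shows "f x \<le> M"
proof -
  have "birkhoff_polytope = convex hull {v. v extreme_point_of (birkhoff_polytope :: 'm point set)}"
    by (rule Krein_Milman_Minkowski[OF compact_birkhoff_polytope convex_birkhoff_polytope])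
  also have "\<dots> \<subseteq> {x. f x \<le> M}"
    by (rule hull_minimal) (use assms quasi_convex_sublevel_convex in auto)
  finally show ?thesis
    using assms(3) by auto
qed

section \<open>Points of the perturbed polytope near Birkhoff points\<close>

lemma sum_UNIV_option:
  fixes g :: "'a::finite option \<Rightarrow> 'b::comm_monoid_add"
  shows "(\<Sum>j\<in>UNIV. g j) = g None + (\<Sum>j\<in>UNIV. g (Some j))"
  by (simp add: UNIV_option_conv sum.reindex)

text \<open>
  The witness extends affinely the map sending a permutation matrix with \<open>None\<close> in row \<open>i\<close> to the
  matrix in which that entry drops to \<open>1 - n * t\<close>, the rest of row \<open>i\<close> is filled with \<open>t\<close>, and all
  other ones become \<open>1 - t\<close>.
\<close>

lemma perturbed_polytope_near:
  fixes v :: "'m::finite point"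
  defines "n \<equiv> real CARD('m option)"
  assumes v: "v \<in> birkhoff_polytope" and t: "0 < t" "n * t \<le> 1"
  obtains y where "y \<in> perturbed_polytope t" and "norm (v - y) \<le> n * (2 * n - 1) * t"
proof
  define y :: "'m point" where
    "y = (\<chi> k. case snd k of None \<Rightarrow> (1 - n * t) * v $ k
            | Some j \<Rightarrow> (1 - t) * v $ k + t * v $ (fst k, None))"
  have yN: "y $ (i, None) = (1 - n * t) * v $ (i, None)"
    and yS: "y $ (i, Some j) = (1 - t) * v $ (i, Some j) + t * v $ (i, None)" for i j
    by (simp_all add: y_def)
  have n: "n = 1 + real CARD('m)"
    by (simp add: n_def card_UNIV_option)
  have n2: "2 \<le> n"
    using card_option_ge_2[where 'm = 'm] by (simp add: n_def)
  have row: "(\<Sum>j\<in>UNIV. v $ (i, j)) = 1" and col: "(\<Sum>i\<in>UNIV. v $ (i, Some j)) = 1"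
    and nonneg: "0 \<le> v $ k" for i j k
    using v unfolding birkhoff_polytope_def by blast+
  have rowS: "(\<Sum>j\<in>UNIV. v $ (i, Some j)) = 1 - v $ (i, None)" for i
    using row[of i] by (simp add: sum_UNIV_option)
  \<comment> \<open>The omitted column sum is recovered by counting: all entries sum to n, and the
    other columns account for n - 1 of it.\<close>
  have "(\<Sum>i\<in>UNIV. \<Sum>j\<in>UNIV. v $ (i, Some j)) = real CARD('m)"
    by (subst sum.swap) (simp add: col)
  then have colN: "(\<Sum>i\<in>UNIV. v $ (i, None)) = 1"
    using n by (simp add: rowS sum_subtractf n_def)
  have t1: "t \<le> 1"
  proof -
    have "1 * t \<le> n * t"
      using n2 t by (intro mult_right_mono) auto
    then show ?thesis using t by linarith
  qed
  have "0 \<le> y $ (i, j)" for i j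
    using t t1 nonneg by (cases j) (auto simp: yN yS)
  moreover have "(\<Sum>j\<in>UNIV. y $ (i, j)) = 1 - t" for i
    by (simp add: sum_UNIV_option yN yS sum.distrib rowS n flip: sum_distrib_left)
       (simp add: algebra_simps)
  moreover have "(\<Sum>i\<in>UNIV. y $ (i, Some j)) = 1" for j
    by (simp add: yS sum.distrib col colN flip: sum_distrib_left)
  ultimately show "y \<in> perturbed_polytope t"
    by (auto simp: perturbed_polytope_def)
  have "norm (v - y) \<le> (\<Sum>k\<in>UNIV. \<bar>(v - y) $ k\<bar>)"
    by (rule norm_le_l1_cart)
  also have "\<dots> = (\<Sum>i\<in>UNIV. \<Sum>j\<in>UNIV. \<bar>v $ (i, j) - y $ (i, j)\<bar>)"
    by (simp add: sum.cartesian_product case_prod_unfold)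
  also have "\<dots> \<le> (\<Sum>i\<in>UNIV. n * t * v $ (i, None)
      + (\<Sum>j\<in>UNIV. t * v $ (i, Some j) + t * v $ (i, None)))"
  proof (rule sum_mono)
    fix i
    have N: "\<bar>v $ (i, None) - y $ (i, None)\<bar> \<le> n * t * v $ (i, None)"
      using n2 t nonneg[of "(i, None)"] by (simp add: yN algebra_simps)
    have S: "\<bar>v $ (i, Some j) - y $ (i, Some j)\<bar> \<le> t * v $ (i, Some j) + t * v $ (i, None)" for j
    proof -
      have "v $ (i, Some j) - y $ (i, Some j) = t * v $ (i, Some j) - t * v $ (i, None)"
        by (simp add: yS algebra_simps)
      moreover have "0 \<le> t * v $ (i, Some j)" "0 \<le> t * v $ (i, None)"
        using t nonneg by auto
      ultimately show ?thesis by linarith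
    qed
    show "(\<Sum>j\<in>UNIV. \<bar>v $ (i, j) - y $ (i, j)\<bar>) \<le> n * t * v $ (i, None)
        + (\<Sum>j\<in>UNIV. t * v $ (i, Some j) + t * v $ (i, None))"
      unfolding sum_UNIV_option by (intro add_mono N sum_mono S)
  qed
  \<comment> \<open>The row bounds add up to \<open>(2 * n - 2) * t\<close>, since column
    \<open>None\<close> sums to 1, plus \<open>t\<close> for each of the n rows.\<close>
  also have "\<dots> = (3 * n - 2) * t"
  proof -
    have "n * t * v $ (i, None) + (\<Sum>j\<in>UNIV. t * v $ (i, Some j) + t * v $ (i, None))
        = (2 * n - 2) * t * v $ (i, None) + t" for i
      by (simp add: sum.distrib rowS n flip: sum_distrib_left) (simp add: algebra_simps)
    then show ?thesis
      by (simp add: sum.distrib colN flip: sum_distrib_left n_def) (simp add: algebra_simps n_def)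
  qed
  \<comment> \<open>Weakened to the bound that also holds between \<open>xhat\<close> and
    \<open>xstar\<close>, so that one condition on \<open>t\<close> serves both.\<close>
  also have "\<dots> \<le> n * (2 * n - 1) * t"
  proof -
    have "n * (2 * n - 1) - (3 * n - 2) = 2 * (n - 1)\<^sup>2"
      by (simp add: power2_eq_square algebra_simps)
    then have "3 * n - 2 \<le> n * (2 * n - 1)"
      by (smt (verit) zero_le_power2)
    then show ?thesis
      using t by (intro mult_right_mono) auto
  qed
  finally show "norm (v - y) \<le> n * (2 * n - 1) * t" .
qed

section \<open>Integrality and perturbation of basic solutions\<close>

lemma basic_solution_diff:
  "basic_solution A \<pi> c - basic_solution A \<pi> d = basic_solution A \<pi> (c - d)"
  by (simp add: vec_eq_iff basic_solution_def matrix_vector_mult_diff_distrib)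

text \<open>For the all-ones right-hand side each basic coordinate is a row sum of the inverse,
  whose entries are integers.\<close>

lemma basic_solution_birkhoff_Ints:
  fixes \<pi> :: "'m::finite option + 'm \<Rightarrow> 'm option \<times> 'm option"
  assumes "is_basis constraint_matrix \<pi>"
  shows "basic_solution constraint_matrix \<pi> birkhoff_rhs $ k \<in> \<int>"
proof -
  have "matrix_inv (basis_matrix constraint_matrix \<pi>) $ r $ q \<in> \<int>" for r q
    using constraint_basis_inverse_entry[OF assms, of r q] by auto
  then show ?thesis
    by (auto simp: basic_solution_def birkhoff_rhs_def matrix_vector_mult_def intro: Ints_sum)
qed

text \<open>The right-hand sides differ by \<open>t\<close> in the n row-sum positions and agree
  elsewhere, so a basic coordinate is \<open>t\<close> times a sum of n inverse entries, each of
  absolute value at most 1.\<close>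

lemma basic_solution_perturbation_entry:
  fixes \<pi> :: "'m::finite option + 'm \<Rightarrow> 'm option \<times> 'm option"
  assumes "is_basis constraint_matrix \<pi>" and "0 \<le> t"
  shows "\<bar>basic_solution constraint_matrix \<pi> (birkhoff_rhs - perturbed_rhs t) $ k\<bar>
      \<le> (if k \<in> range \<pi> then real CARD('m option) * t else 0)"
proof (cases "k \<in> range \<pi>")
  case True
  define w where "w = (\<lambda>q. matrix_inv (basis_matrix constraint_matrix \<pi>) $ inv \<pi> k $ q)"
  have w: "\<bar>w q\<bar> \<le> 1" for q
    using constraint_basis_inverse_entry[OF assms(1), of "inv \<pi> k" q] by (auto simp: w_def)
  have "basic_solution constraint_matrix \<pi> (birkhoff_rhs - perturbed_rhs t) $ k
      = (\<Sum>i\<in>UNIV. w (Inl i) * t)"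
    using True
    by (simp add: basic_solution_def birkhoff_rhs_def perturbed_rhs_def matrix_vector_mult_def
        w_def sum_UNIV_sum)
  also have "\<bar>\<dots>\<bar> \<le> (\<Sum>i\<in>(UNIV :: 'm option set). t)"
    using w assms(2)
    by (intro order.trans[OF sum_abs] sum_mono) (simp add: abs_mult mult_left_le_one_le)
  finally show ?thesis
    using True by simp
qed (simp add: basic_solution_notin_range)

section \<open>Transfer of optimality to the Birkhoff polytope\<close>

theorem theorem2p10:
  fixes f :: "'m::finite point \<Rightarrow> real"
    and \<pi> :: "'m option + 'm \<Rightarrow> 'm option \<times> 'm option"
    and \<delta> t :: real
    and n :: nat
    and xstar xhat :: "'m point"
  assumes n: "n = CARD('m option)"
    and cont: "continuous_on UNIV f"
    and qconv: "quasi_convex f"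
    and integral: "\<And>v. v extreme_point_of (birkhoff_polytope :: 'm point set) \<Longrightarrow> f v \<in> \<int>"
    and delta: "0 < \<delta>" "\<delta> < 1"
    and delta_f: "\<And>x y. x extreme_point_of (birkhoff_polytope :: 'm point set) \<Longrightarrow>
                    norm (x - y) < \<delta> \<Longrightarrow> \<bar>f x - f y\<bar> < 1 / 2"
    and t: "0 < t" "t < \<delta> / (real n * (2 * real n - 1))"
    and basis: "is_basis constraint_matrix \<pi>"
    and xstar: "xstar = basic_solution constraint_matrix \<pi> (perturbed_rhs t)"
    and feasible: "xstar \<in> perturbed_polytope t"
    and optimal: "\<And>x. x \<in> perturbed_polytope t \<Longrightarrow> f x \<le> f xstar"
    and xhat: "xhat = basic_solution constraint_matrix \<pi> birkhoff_rhs"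
  shows "xhat \<in> birkhoff_polytope \<and> (\<forall>x \<in> birkhoff_polytope. f x \<le> f xhat)"
proof -
  have n2: "2 \<le> n"
    using card_option_ge_2[where 'm = 'm] by (simp add: n)
  then have pos: "0 < real n * (2 * real n - 1)"
    by simp
  have small: "real n * (2 * real n - 1) * t < \<delta>"
    using t(2) pos by (simp add: pos_less_divide_eq mult.commute)
  have "real n * t * 1 \<le> real n * t * (2 * real n - 1)"
    using n2 t(1) by (intro mult_left_mono) auto
  then have nt: "real n * t < 1"
    using small delta(2) by (simp add: mult_ac)

  have entry: "\<bar>(xhat - xstar) $ k\<bar> \<le> (if k \<in> range \<pi> then real n * t else 0)" for k
    unfolding xhat xstar basic_solution_diff n
    using basic_solution_perturbation_entry[OF basis, of t] t(1) by simp
  have nonneg: "0 \<le> xhat $ k" for k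
  proof -
    have "\<bar>(xhat - xstar) $ k\<bar> \<le> real n * t"
      using entry[of k] t(1) by (auto split: if_splits)
    moreover have "0 \<le> xstar $ k"
      using feasible unfolding perturbed_polytope_def by blast
    ultimately have "-1 < xhat $ k"
      using nt by simp
    moreover have "xhat $ k \<in> \<int>"
      unfolding xhat by (rule basic_solution_birkhoff_Ints[OF basis])
    ultimately show ?thesis
      by (auto elim!: Ints_cases)
  qed
  have ext: "xhat extreme_point_of birkhoff_polytope"
    unfolding birkhoff_polytope_eq
    using basic_solution_extreme_point[OF basis, of birkhoff_rhs] nonneg by (simp add: xhat)
  have "norm (xhat - xstar) \<le> (\<Sum>k\<in>UNIV. \<bar>(xhat - xstar) $ k\<bar>)"
    by (rule norm_le_l1_cart)
  also have "\<dots> \<le> (\<Sum>k\<in>UNIV. if k \<in> range \<pi> then real n * t else 0)"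
    by (intro sum_mono entry)
  also have "\<dots> = (\<Sum>k\<in>range \<pi>. real n * t)"
    by (simp add: sum.If_cases)
  \<comment> \<open>As \<open>\<pi>\<close> is injective, its range has as many elements as there
    are equations, n + (n - 1).\<close>
  also have "\<dots> = real n * (2 * real n - 1) * t"
    using card_image[OF is_basis_inj[OF basis]]
    by (simp add: n card_UNIV_option algebra_simps)
  finally have close: "\<bar>f xhat - f xstar\<bar> < 1 / 2"
    using small ext by (intro delta_f) auto

  have "f v \<le> f xhat" if v: "v extreme_point_of birkhoff_polytope" for v
  proof -
    have "v \<in> birkhoff_polytope"
      using v by (simp add: extreme_point_of_def)
    then obtain y where "y \<in> perturbed_polytope t"
      and "norm (v - y) \<le> real n * (2 * real n - 1) * t"
      using perturbed_polytope_near[of v t] t(1) nt n by auto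
    then have "\<bar>f v - f y\<bar> < 1 / 2" and "f y \<le> f xstar"
      using small delta_f[OF v, of y] optimal by auto
    \<comment> \<open>Chain:
      \<open>f v < f y + 1 / 2 \<le> f xstar + 1 / 2 < f xhat + 1\<close>.\<close>
    then have "f v < f xhat + 1"
      using close by linarith
    moreover obtain a b :: int where "f v = of_int a" "f xhat = of_int b"
      using integral[OF v] integral[OF ext] by (auto elim!: Ints_cases)
    ultimately show ?thesis
      by simp
  qed
  then have "f x \<le> f xhat" if "x \<in> birkhoff_polytope" for x
    using quasi_convex_le_on_birkhoff[OF qconv _ that] by blast
  then show ?thesis
    using ext by (simp add: extreme_point_of_def)
qed

end
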